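(* Let $N > 0$ and $0 \leqslant n_0 < \dots < n_{N-1} < M < n_N < \dots < n_{2N-1}$ be integers, and let $c_{n_0},\dots,c_{n_{2N-1}}$ be positive reals. Then there exists a negative number $c_M$ such that $$x \mapsto c_{n_0} x^{n_0} + c_{n_1} x^{n_1} + \dots + c_{n_{N-1}} x^{n_{N-1}} + c_M x^M + c_{n_N} x^{n_N} + \dots + c_{n_{2N-1}} x^{n_{2N-1}}$$ entrywise preserves positivity on $\mathbb{P}_N((0,+\infty))$.
   Context: For $I \subset \mathbb{C}$, $\mathbb{P}_N(I)$ denotes the set of positive semidefinite Hermitian $N\times N$ matrices all of whose entries lie in $I$. For a function $f$ on $I$ and a matrix $A=(a_{jk})$ with entries in $I$, $f[A] := (f(a_{jk}))$ is the entrywise application of $f$. The function $f$ entrywise preserves positivity on $\mathbb{P}_N(I)$ if $f[A]$ is positive semidefinite for every $A \in \mathbb{P}_N(I)$. *)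

theory Defs
  imports "Jordan_Normal_Form.Schur_Decomposition"
begin

definition hermitian_mat :: "complex mat \<Rightarrow> bool" where
  "hermitian_mat A \<longleftrightarrow> square_mat A \<and> mat_adjoint A = A"

text \<open>The inequality below is that of the partial order on the complex numbers from
  \<^theory>\<open>HOL-Library.Complex_Order\<close>: \<open>0 \<le> z\<close> says that \<open>z\<close> is real and nonnegative.\<close>

definition positive_semidefinite :: "complex mat \<Rightarrow> bool" where
  "positive_semidefinite A \<longleftrightarrow>
     hermitian_mat A \<and> (\<forall>v \<in> carrier_vec (dim_row A). 0 \<le> (A *\<^sub>v v) \<bullet>c v)"

definition psd_matrices :: "nat \<Rightarrow> complex set \<Rightarrow> complex mat set" where
  "psd_matrices N I =
     {A \<in> carrier_mat N N. positive_semidefinite A \<and> elements_mat A \<subseteq> I}"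

text \<open>A function on \<open>I\<close> is represented by a total function; only its values on \<open>I\<close> matter.\<close>

definition entrywise_preserves_positivity ::
    "nat \<Rightarrow> complex set \<Rightarrow> (complex \<Rightarrow> complex) \<Rightarrow> bool" where
  "entrywise_preserves_positivity N I f \<longleftrightarrow>
     (\<forall>A \<in> psd_matrices N I. positive_semidefinite (map_mat f A))"

end

theory Submission
  imports Defs "HOL-Analysis.Convex"
begin

text \<open>
A negative coefficient at \<open>x ^ M\<close> can be paid for by the other terms if it is small. On a rank-one
matrix \<open>u i * u j\<close> the quadratic form of \<open>f[A]\<close> is a combination of the squares of the numbers
\<open>w e = (\<Sum>i\<in>I. v i * u i ^ e)\<close>, and only the square of \<open>w M\<close> enters negatively. So one needs
\<open>w M\<close> to be a combination of the other \<open>w e\<close> whose coefficients are bounded independently of the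
positive vector \<open>u\<close>, that is, one has to interpolate \<open>x ^ M\<close> at any \<open>N\<close> or fewer positive points by
the other powers with bounded coefficients (lemma \<open>bounded_interpolation\<close>). The points may tend to
0, to infinity or to each other. Since \<open>x ^ M\<close> is dominated by the lower powers on \<open>(0, 1]\<close> and by
the higher ones on \<open>[1, \<infinity>)\<close>, the interpolant uses as many lower exponents as there are points in
\<open>(0, 1]\<close>, and as many higher ones as there are points beyond 1; this is where \<open>N\<close> exponents on each
side of \<open>M\<close> come in.

With that choice, \<open>x ^ M\<close> minus its interpolant is an exponential sum with one more term than it has
known positive roots. The operator \<open>x * d/dx - s\<close> removes the exponent \<open>s\<close> and, by Rolle, costs only
one root. Removing all lower exponents except \<open>j\<close> consumes all but one of the roots in \<open>(0, 1]\<close>, so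
that \<open>j\<close> and \<open>M\<close> become the two lowest exponents and the smallest root is at most 1. At the
smallest root of such an extremal sum, the lowest term is no larger in absolute value than the next
one (\<open>lowest_coeff_le_next\<close>), which bounds the coefficient at \<open>j\<close> (\<open>lower_coeff_bound\<close>). The
reflection \<open>x \<mapsto> 1 / x\<close> treats the higher exponents.

The passage from rank one to all positive semidefinite matrices follows FitzGerald and Horn. If \<open>A\<close>
has the last column of the rank-one matrix \<open>z i * z j\<close>, then \<open>D i j = A i j - z i * z j\<close> is positive
semidefinite and vanishes in the last row and column, and the quadratic form of \<open>f[z z\<^sup>T + t D]\<close> has as
derivative in \<open>t\<close> the quadratic form of the entrywise product of \<open>D\<close> with \<open>f'[z z\<^sup>T + t D]\<close>. It is
nonnegative by the Schur product theorem if \<open>f'\<close> preserves positivity in one dimension less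
(\<open>entrywise_psd_by_derivative\<close>). The derivative of a sum of the given shape again has this shape, so
an induction on the dimension finishes the proof (\<open>entrywise_polynomial_psd\<close>).
\<close>

section \<open>Exponential sums and Rolle's theorem\<close>

text \<open>Exponents are real because the reflection \<open>x \<mapsto> 1 / x\<close> negates them.\<close>
definition exp_sum :: "(real \<Rightarrow> real) \<Rightarrow> real set \<Rightarrow> real \<Rightarrow> real" where
  "exp_sum c E x = (\<Sum>e\<in>E. c e * x powr e)"

lemma exp_sum_shift:
  assumes "x > 0"
  shows "exp_sum c E x = x powr s * (\<Sum>e\<in>E. c e * x powr (e - s))"
  using assms unfolding exp_sum_def sum_distrib_left
  by (intro sum.cong refl) (simp add: powr_diff)

lemma has_derivative_shifted_exp_sum:
  assumes "x > 0"
  shows "((\<lambda>x. \<Sum>e\<in>E. c e * x powr (e - s)) has_real_derivative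
           x powr (- s - 1) * exp_sum (\<lambda>e. c e * (e - s)) E x) (at x)"
proof -
  have "((\<lambda>x. \<Sum>e\<in>E. c e * x powr (e - s)) has_real_derivative
           (\<Sum>e\<in>E. c e * ((e - s) * x powr (e - s - 1)))) (at x)"
    using assms by (auto intro!: derivative_eq_intros sum.cong)
  also have "(\<Sum>e\<in>E. c e * ((e - s) * x powr (e - s - 1)))
      = x powr (- s - 1) * exp_sum (\<lambda>e. c e * (e - s)) E x"
    unfolding exp_sum_def sum_distrib_left
  proof (intro sum.cong refl)
    fix e
    have "x powr (e - s - 1) = x powr (- s - 1) * x powr e"
      using powr_add[of x "- s - 1" e] by (simp add: algebra_simps)
    then show "c e * ((e - s) * x powr (e - s - 1)) = x powr (- s - 1) * (c e * (e - s) * x powr e)"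
      by simp
  qed
  finally show ?thesis .
qed

text \<open>Up to a positive factor, \<open>exp_sum (\<lambda>e. c e * (e - s)) E\<close> is the derivative of \<open>x powr (- s) * exp_sum c E x\<close>,
so this is Rolle's theorem for the latter function. The coefficient at the exponent \<open>s\<close> is lost.\<close>
lemma exp_sum_rolle:
  assumes "0 < a" "a < b" "exp_sum c E a = 0" "exp_sum c E b = 0"
  shows "\<exists>y. a < y \<and> y < b \<and> exp_sum (\<lambda>e. c e * (e - s)) E y = 0"
proof -
  let ?g = "\<lambda>x. \<Sum>e\<in>E. c e * x powr (e - s)"
  have d: "(?g has_real_derivative x powr (- s - 1) * exp_sum (\<lambda>e. c e * (e - s)) E x) (at x)"
    if "a \<le> x" for x
    using that assms(1) by (intro has_derivative_shifted_exp_sum) simp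
  have "?g a = ?g b"
    using assms exp_sum_shift[of a c E s] exp_sum_shift[of b c E s] by simp
  moreover have "continuous_on {a..b} ?g"
    by (rule DERIV_continuous_on) (use d in \<open>auto intro: has_field_derivative_at_within\<close>)
  moreover have "?g differentiable (at x)" if "a < x" for x
    unfolding real_differentiable_def using d[OF less_imp_le[OF that]] by blast
  ultimately obtain y where y: "a < y" "y < b" "DERIV ?g y :> 0"
    using Rolle[OF assms(2), of ?g] by blast
  have "y powr (- s - 1) * exp_sum (\<lambda>e. c e * (e - s)) E y = 0"
    by (rule DERIV_unique[OF d[OF less_imp_le[OF y(1)]] y(3)])
  then show ?thesis
    using y assms(1) by auto
qed

text \<open>Besides the number of surviving roots, the intervals containing them are recorded: the smallest new
root does not exceed the old root with index \<open>card D\<close>.\<close>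
lemma exp_sum_rolle_chain:
  assumes "finite D"
    and "\<And>i. i < m + card D \<Longrightarrow> 0 < u i \<and> exp_sum c E (u i) = 0"
    and "\<And>i. Suc i < m + card D \<Longrightarrow> u i < u (Suc i)"
  shows "\<exists>w. (\<forall>i<m. u i \<le> w i \<and> w i \<le> u (i + card D)
              \<and> exp_sum (\<lambda>e. c e * (\<Prod>d\<in>D. e - d)) E (w i) = 0)
           \<and> (\<forall>i. Suc i < m \<longrightarrow> w i < w (Suc i))"
  using assms
proof (induction D arbitrary: u c rule: finite_induct)
  case empty
  then show ?case by auto
next
  case (insert d D)
  have "\<exists>y. i + 1 < m + card (insert d D) \<longrightarrow>
      u i < y \<and> y < u (i + 1) \<and> exp_sum (\<lambda>e. c e * (e - d)) E y = 0" for i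
    using exp_sum_rolle[of "u i" "u (i + 1)" c E d] insert.prems(1)[of i] insert.prems(1)[of "i + 1"]
      insert.prems(2)[of i] by fastforce
  then obtain v where v: "\<And>i. i + 1 < m + card (insert d D) \<Longrightarrow>
      u i < v i \<and> v i < u (i + 1) \<and> exp_sum (\<lambda>e. c e * (e - d)) E (v i) = 0"
    by metis
  have card: "card (insert d D) = Suc (card D)"
    using insert.hyps by simp
  have "\<exists>w. (\<forall>i<m. v i \<le> w i \<and> w i \<le> v (i + card D)
              \<and> exp_sum (\<lambda>e. c e * (e - d) * (\<Prod>d\<in>D. e - d)) E (w i) = 0)
           \<and> (\<forall>i. Suc i < m \<longrightarrow> w i < w (Suc i))"
  proof (rule insert.IH)
    show "0 < v i \<and> exp_sum (\<lambda>e. c e * (e - d)) E (v i) = 0" if "i < m + card D" for i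
      using v[of i] insert.prems(1)[of i] that card by auto
    show "v i < v (Suc i)" if "Suc i < m + card D" for i
      using v[of i] v[of "Suc i"] that card by auto
  qed
  then obtain w where w: "\<And>i. i < m \<Longrightarrow> v i \<le> w i \<and> w i \<le> v (i + card D)
              \<and> exp_sum (\<lambda>e. c e * (e - d) * (\<Prod>d\<in>D. e - d)) E (w i) = 0"
    "\<And>i. Suc i < m \<Longrightarrow> w i < w (Suc i)" by blast
  have "u i \<le> w i \<and> w i \<le> u (i + card (insert d D))" if "i < m" for i
    using w(1)[OF that] v[of i] v[of "i + card D"] that card by force
  moreover have "exp_sum (\<lambda>e. c e * (\<Prod>d\<in>insert d D. e - d)) E (w i) = 0" if "i < m" for i
    using w(1)[OF that] insert.hyps by (simp add: mult.assoc)
  ultimately show ?case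
    using w(2) by blast
qed

section \<open>Extremal exponential sums\<close>

text \<open>A sum with one more term than roots has as many positive roots as Descartes' rule of signs permits,
hence alternating coefficients. The lemma says that not only the coefficients but all the remainders
obtained by dropping lowest terms alternate in sign to the left of the roots. The induction divides by
the lowest power \<open>x powr e\<close> and differentiates: this removes one term and moves the roots to the right
of the first one, the operation commutes with the truncation, and a remainder divided by \<open>x powr e\<close>
tends to 0 at 0, so that its sign is that of its derivative.\<close>
lemma exp_sum_truncation_signs:
  assumes "sorted_wrt (<) es" "r > 0"
    and "\<And>i. i < length es - 1 \<Longrightarrow> r \<le> u i \<and> exp_sum c (set es) (u i) = 0"
    and "\<And>i. Suc i < length es - 1 \<Longrightarrow> u i < u (Suc i)"
  shows "\<exists>\<sigma>\<in>{1, -1}. \<forall>k. \<forall>x\<in>{0<..r}. 0 \<le> \<sigma> * (-1) ^ k * exp_sum c (set (drop k es)) x"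
  using assms
proof (induction es arbitrary: c u r)
  case Nil
  then show ?case by (auto simp: exp_sum_def)
next
  case (Cons e es)
  show ?case
  proof (cases "es = []")
    case True
    then show ?thesis
      by (cases "c e \<ge> 0") (auto simp: exp_sum_def drop_Cons' mult_nonpos_nonneg)
  next
    case False
    define m where "m = length es - 1"
    have m: "length es = Suc m"
      using False by (simp add: m_def)
    have notin: "e \<notin> set es" and gt: "\<And>f. f \<in> set es \<Longrightarrow> e < f"
      using Cons.prems(1) by auto
    have u: "r \<le> u i \<and> exp_sum c (set (e # es)) (u i) = 0" if "i \<le> m" for i
      using Cons.prems(3)[of i] that m by simp
    have "\<exists>y. i < m \<longrightarrow>
        u i < y \<and> y < u (Suc i) \<and> exp_sum (\<lambda>f. c f * (f - e)) (set (e # es)) y = 0" for i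
      using exp_sum_rolle[of "u i" "u (Suc i)" c "set (e # es)" e] u[of i] u[of "Suc i"]
        Cons.prems(4)[of i] Cons.prems(2) m by fastforce
    then obtain v where v: "\<And>i. i < m \<Longrightarrow>
        u i < v i \<and> v i < u (Suc i) \<and> exp_sum (\<lambda>f. c f * (f - e)) (set (e # es)) (v i) = 0"
      by metis
    have drop_e: "exp_sum (\<lambda>f. c f * (f - e)) (set (e # es)) x
        = exp_sum (\<lambda>f. c f * (f - e)) (set es) x" for x
      using notin by (simp add: exp_sum_def)
    have u0_le: "u 0 \<le> u i" if "i \<le> m" for i
      using that
    proof (induction i)
      case (Suc i)
      then show ?case using Cons.prems(4)[of i] m by fastforce
    qed simp
    have u0: "u 0 > 0" "r \<le> u 0" using u[of 0] Cons.prems(2) by auto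
    have "\<exists>\<tau>\<in>{1, -1}. \<forall>k. \<forall>x\<in>{0<..u 0}.
        0 \<le> \<tau> * (-1) ^ k * exp_sum (\<lambda>f. c f * (f - e)) (set (drop k es)) x"
    proof (rule Cons.IH)
      show "sorted_wrt (<) es" using Cons.prems(1) by simp
      show "u 0 > 0" by fact
      show "u 0 \<le> v i \<and> exp_sum (\<lambda>f. c f * (f - e)) (set es) (v i) = 0"
        if "i < length es - 1" for i
        using v[of i] u0_le[of i] that drop_e m by fastforce
      show "v i < v (Suc i)" if "Suc i < length es - 1" for i
        using v[of i] v[of "Suc i"] that m by fastforce
    qed
    then obtain \<tau> where \<tau>: "\<tau> \<in> {1, -1}" and IH_ball: "\<forall>k. \<forall>x\<in>{0<..u 0}.
        0 \<le> \<tau> * (-1) ^ k * exp_sum (\<lambda>f. c f * (f - e)) (set (drop k es)) x"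
      by blast
    have IH: "0 \<le> \<tau> * (-1) ^ k * exp_sum (\<lambda>f. c f * (f - e)) (set (drop k es)) x"
      if "0 < x" "x \<le> u 0" for k x
      using IH_ball that by simp
    define G where "G k x = (\<Sum>f\<in>set (drop k es). c f * x powr (f - e))" for k x
    have in_es: "f \<in> set es" if "f \<in> set (drop k es)" for f k
      using that by (meson in_set_dropD)
    have cont: "continuous_on {0..} (G k)" for k
      unfolding G_def using gt in_es
      by (intro continuous_intros continuous_on_powr') auto
    have mono: "\<tau> * (-1) ^ k * G k x \<le> \<tau> * (-1) ^ k * G k y"
      if "0 \<le> x" "x \<le> y" "y \<le> u 0" for k x y
    proof (rule DERIV_nonneg_imp_increasing_open[OF \<open>x \<le> y\<close>])
      fix z assume z: "x < z" "z < y"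
      have "(G k has_real_derivative
          z powr (- e - 1) * exp_sum (\<lambda>f. c f * (f - e)) (set (drop k es)) z) (at z)"
        unfolding G_def using z that by (intro has_derivative_shifted_exp_sum) simp
      then have "((\<lambda>z. \<tau> * (-1) ^ k * G k z) has_real_derivative \<tau> * (-1) ^ k *
          (z powr (- e - 1) * exp_sum (\<lambda>f. c f * (f - e)) (set (drop k es)) z)) (at z)"
        by (intro DERIV_cmult)
      moreover have "0 \<le> z powr (- e - 1) *
          (\<tau> * (-1) ^ k * exp_sum (\<lambda>f. c f * (f - e)) (set (drop k es)) z)"
        using z that by (intro mult_nonneg_nonneg IH) auto
      ultimately show "\<exists>d. ((\<lambda>z. \<tau> * (-1) ^ k * G k z) has_real_derivative d) (at z) \<and> 0 \<le> d"
        by (auto simp: mult_ac)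
    next
      show "continuous_on {x..y} (\<lambda>z. \<tau> * (-1) ^ k * G k z)"
        using that by (intro continuous_intros continuous_on_subset[OF cont]) auto
    qed
    have G0: "G k 0 = 0" for k
      by (simp add: G_def)
    have shift: "exp_sum c (set (drop k es)) x = x powr e * G k x" if "x > 0" for k x
      unfolding G_def using that by (rule exp_sum_shift)
    have tail: "0 \<le> \<tau> * (-1) ^ k * exp_sum c (set (drop k es)) x" if "0 < x" "x \<le> u 0" for k x
    proof -
      have "0 \<le> x powr e * (\<tau> * (-1) ^ k * G k x)"
        using mono[of 0 x k] that by (simp add: G0)
      then show ?thesis
        using that by (simp add: shift mult_ac)
    qed
    have whole: "exp_sum c (set (e # es)) x = x powr e * (c e + G 0 x)" if "x > 0" for x
      using shift[OF that, of 0] notin by (simp add: exp_sum_def algebra_simps)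
    have "c e + G 0 (u 0) = 0"
      using u[of 0] whole[of "u 0"] u0 by simp
    have "\<tau> * (c e + G 0 x) \<le> 0" if "0 < x" "x \<le> u 0" for x
    proof -
      have "\<tau> * G 0 x \<le> \<tau> * G 0 (u 0)"
        using mono[of x "u 0" 0] that by simp
      then have "\<tau> * (c e + G 0 x) \<le> \<tau> * (c e + G 0 (u 0))"
        by (simp add: distrib_left)
      then show ?thesis
        using \<open>c e + G 0 (u 0) = 0\<close> by simp
    qed
    then have "x powr e * (\<tau> * (c e + G 0 x)) \<le> 0" if "0 < x" "x \<le> u 0" for x
      using that by (simp add: mult_nonneg_nonpos)
    then have head: "\<tau> * exp_sum c (set (e # es)) x \<le> 0" if "0 < x" "x \<le> u 0" for x
      using that whole[OF that(1)] by (simp add: mult_ac)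
    have "0 \<le> - \<tau> * (-1) ^ k * exp_sum c (set (drop k (e # es))) x" if "0 < x" "x \<le> r" for k x
    proof (cases k)
      case 0
      then show ?thesis using head[of x] that u0 by simp
    next
      case (Suc l)
      then show ?thesis using tail[of x l] that u0 by simp
    qed
    then show ?thesis
      using \<tau> by (intro bexI[of _ "- \<tau>"]) auto
  qed
qed

text \<open>At the smallest root the whole sum vanishes, so the remainder after one term equals minus the first
term and the remainder after two terms equals minus the sum of the first two. By the previous lemma
these two remainders have opposite signs.\<close>
lemma lowest_coeff_le_next:
  assumes "sorted_wrt (<) (a # b # es)"
    and "\<And>i. i \<le> length es \<Longrightarrow> 0 < u i \<and> exp_sum c (set (a # b # es)) (u i) = 0"
    and "\<And>i. i < length es \<Longrightarrow> u i < u (Suc i)"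
  shows "\<bar>c a\<bar> * u 0 powr a \<le> \<bar>c b\<bar> * u 0 powr b"
proof -
  have u0_le: "u 0 \<le> u i" if "i \<le> length es" for i
    using that
  proof (induction i)
    case (Suc i)
    then show ?case using assms(3)[of i] by fastforce
  qed simp
  have u0: "u 0 > 0" using assms(2)[of 0] by simp
  have "\<exists>\<sigma>\<in>{1, -1}. \<forall>k. \<forall>x\<in>{0<..u 0}.
      0 \<le> \<sigma> * (-1) ^ k * exp_sum c (set (drop k (a # b # es))) x"
    using assms u0_le u0 by (intro exp_sum_truncation_signs[of _ _ u]) auto
  then obtain \<sigma> :: real where \<sigma>: "\<sigma> \<in> {1, -1}" and sgn_ball: "\<forall>k. \<forall>x\<in>{0<..u 0}.
      0 \<le> \<sigma> * (-1) ^ k * exp_sum c (set (drop k (a # b # es))) x"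
    by blast
  have sgn: "0 \<le> \<sigma> * (-1) ^ k * exp_sum c (set (drop k (a # b # es))) (u 0)" for k
    using sgn_ball u0 by simp
  have "a \<noteq> b" "a \<notin> set es" "b \<notin> set es"
    using assms(1) by auto
  then have "exp_sum c (set (a # b # es)) (u 0) = c a * u 0 powr a + exp_sum c (set (b # es)) (u 0)"
    "exp_sum c (set (b # es)) (u 0) = c b * u 0 powr b + exp_sum c (set es) (u 0)"
    by (auto simp: exp_sum_def)
  then have *: "exp_sum c (set (b # es)) (u 0) = - (c a * u 0 powr a)"
    "exp_sum c (set es) (u 0) = - (c a * u 0 powr a) - c b * u 0 powr b"
    using assms(2)[of 0] by auto
  have "0 \<le> \<sigma> * (c a * u 0 powr a)" "0 \<le> \<sigma> * (- (c a * u 0 powr a) - c b * u 0 powr b)"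
    using sgn[of 1] sgn[of 2] * by simp_all
  then have "\<bar>c a * u 0 powr a\<bar> \<le> \<bar>c b * u 0 powr b\<bar>"
    using \<sigma> by auto
  then show ?thesis
    by (simp add: abs_mult)
qed

text \<open>The case to have in mind is that \<open>card A\<close> of the roots lie in \<open>(0, 1]\<close>. Rolle's theorem removes
the exponents in \<open>A - {j}\<close>, after which \<open>j\<close> and \<open>\<mu>\<close> are the lowest ones and the smallest root is
still at most 1. There \<open>x powr \<mu> \<le> x powr j\<close>, so comparing the two lowest terms bounds the
coefficient at \<open>j\<close>. The products are the factors that the coefficients have collected.\<close>
lemma lower_coeff_bound:
  fixes A B :: "real set"
  assumes "finite A" "finite B" "\<And>a. a \<in> A \<Longrightarrow> a < \<mu>" "\<And>b. b \<in> B \<Longrightarrow> \<mu> < b"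
    and u: "\<And>i. i < card A + card B \<Longrightarrow> 0 < u i \<and> exp_sum c (insert \<mu> (A \<union> B)) (u i) = 0"
    and u_less: "\<And>i. Suc i < card A + card B \<Longrightarrow> u i < u (Suc i)"
    and le1: "u (card A - 1) \<le> 1"
    and j: "j \<in> A"
  shows "\<bar>c j\<bar> * (\<Prod>a\<in>A - {j}. \<bar>j - a\<bar>) \<le> \<bar>c \<mu>\<bar> * (\<Prod>a\<in>A - {j}. \<bar>\<mu> - a\<bar>)"
proof -
  define D where "D = A - {j}"
  define c' where "c' e = c e * (\<Prod>d\<in>D. e - d)" for e
  define es where "es = sorted_list_of_set B"
  have es: "set es = B" "length es = card B" "sorted_wrt (<) es"
    using assms(2) by (simp_all add: es_def)
  have cD: "card A = Suc (card D)"
    using card_Suc_Diff1[OF assms(1) j] by (simp add: D_def)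
  have finD: "finite D" using assms(1) by (simp add: D_def)
  have "\<exists>w. (\<forall>i<Suc (card B). u i \<le> w i \<and> w i \<le> u (i + card D)
              \<and> exp_sum (\<lambda>e. c e * (\<Prod>d\<in>D. e - d)) (insert \<mu> (A \<union> B)) (w i) = 0)
           \<and> (\<forall>i. Suc i < Suc (card B) \<longrightarrow> w i < w (Suc i))"
    using finD u u_less cD by (intro exp_sum_rolle_chain) auto
  then obtain w where w: "\<And>i. i \<le> card B \<Longrightarrow> u i \<le> w i \<and> w i \<le> u (i + card D)
              \<and> exp_sum c' (insert \<mu> (A \<union> B)) (w i) = 0"
    and w_less: "\<And>i. i < card B \<Longrightarrow> w i < w (Suc i)"
    unfolding c'_def by (auto simp: less_Suc_eq_le Suc_le_eq)
  have kill: "exp_sum c' (insert \<mu> (A \<union> B)) x = exp_sum c' (set (j # \<mu> # es)) x" for x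
    unfolding exp_sum_def
  proof (rule sum.mono_neutral_right)
    show "finite (insert \<mu> (A \<union> B))" using assms(1,2) by simp
    show "set (j # \<mu> # es) \<subseteq> insert \<mu> (A \<union> B)" using j es by auto
    show "\<forall>i\<in>insert \<mu> (A \<union> B) - set (j # \<mu> # es). c' i * x powr i = 0"
      using es finD by (auto simp: c'_def D_def prod_zero_iff)
  qed
  have "\<bar>c' j\<bar> * w 0 powr j \<le> \<bar>c' \<mu>\<bar> * w 0 powr \<mu>"
  proof (rule lowest_coeff_le_next)
    show "sorted_wrt (<) (j # \<mu> # es)"
      using es assms(3,4) j by fastforce
    show "0 < w i \<and> exp_sum c' (set (j # \<mu> # es)) (w i) = 0" if "i \<le> length es" for i
      using w[of i] u[of i] that es cD unfolding kill by fastforce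
    show "w i < w (Suc i)" if "i < length es" for i
      using w_less that es by simp
  qed
  moreover have w0: "0 < w 0" "w 0 \<le> 1"
    using w[of 0] u[of 0] le1 cD by auto
  moreover have "w 0 powr \<mu> \<le> w 0 powr j"
    using w0 assms(3)[OF j] by (intro powr_mono') auto
  ultimately have "\<bar>c' j\<bar> * w 0 powr j \<le> \<bar>c' \<mu>\<bar> * w 0 powr j"
    by (meson abs_ge_zero mult_left_mono order_trans)
  then have "\<bar>c' j\<bar> \<le> \<bar>c' \<mu>\<bar>"
    using w0 by simp
  then show ?thesis
    by (simp add: c'_def D_def abs_mult abs_prod)
qed

text \<open>The previous lemma for the roots \<open>1 / u i\<close>, in reversed order, and the negated exponents.\<close>
lemma upper_coeff_bound:
  fixes A B :: "real set"
  assumes "finite A" "finite B" "\<And>a. a \<in> A \<Longrightarrow> a < \<mu>" "\<And>b. b \<in> B \<Longrightarrow> \<mu> < b"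
    and u: "\<And>i. i < card A + card B \<Longrightarrow> 0 < u i \<and> exp_sum c (insert \<mu> (A \<union> B)) (u i) = 0"
    and u_less: "\<And>i. Suc i < card A + card B \<Longrightarrow> u i < u (Suc i)"
    and ge1: "1 \<le> u (card A)"
    and j: "j \<in> B"
  shows "\<bar>c j\<bar> * (\<Prod>b\<in>B - {j}. \<bar>j - b\<bar>) \<le> \<bar>c \<mu>\<bar> * (\<Prod>b\<in>B - {j}. \<bar>\<mu> - b\<bar>)"
proof -
  define m where "m = card A + card B"
  define v where "v i = inverse (u (m - 1 - i))" for i
  have cards: "card (uminus ` B) = card B" "card (uminus ` A) = card A"
    by (simp_all add: card_image)
  have cB: "card B > 0" using assms(2) j by (auto simp: card_gt_0_iff)
  have reflect: "exp_sum (\<lambda>e. c (- e)) (insert (- \<mu>) (uminus ` B \<union> uminus ` A)) (inverse x)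
      = exp_sum c (insert \<mu> (A \<union> B)) x" if "x > 0" for x
  proof -
    define E where "E = insert \<mu> (A \<union> B)"
    have "insert (- \<mu>) (uminus ` B \<union> uminus ` A) = uminus ` E"
      by (auto simp: E_def)
    moreover have "(\<Sum>e\<in>uminus ` E. c (- e) * inverse x powr e) = (\<Sum>e\<in>E. c e * inverse x powr (- e))"
      by (subst sum.reindex) simp_all
    moreover have "inverse x powr (- e) = x powr e" for e
      using that by (simp add: powr_minus inverse_powr)
    ultimately show ?thesis
      by (simp add: exp_sum_def E_def)
  qed
  have "\<bar>c (- (- j))\<bar> * (\<Prod>a\<in>uminus ` B - {- j}. \<bar>- j - a\<bar>)
      \<le> \<bar>c (- (- \<mu>))\<bar> * (\<Prod>a\<in>uminus ` B - {- j}. \<bar>- \<mu> - a\<bar>)"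
  proof (rule lower_coeff_bound[where u = v and B = "uminus ` A"])
    fix i assume i: "i < card (uminus ` B) + card (uminus ` A)"
    then show "0 < v i \<and> exp_sum (\<lambda>e. c (- e)) (insert (- \<mu>) (uminus ` B \<union> uminus ` A)) (v i) = 0"
      using u[of "m - 1 - i"] reflect[of "u (m - 1 - i)"] by (auto simp: v_def m_def cards)
  next
    fix i assume i: "Suc i < card (uminus ` B) + card (uminus ` A)"
    then have "Suc (m - 1 - Suc i) = m - 1 - i" "m - 1 - i < m"
      by (auto simp: m_def cards)
    then show "v i < v (Suc i)"
      using u_less[of "m - 1 - Suc i"] u[of "m - 1 - Suc i"]
      by (auto simp: v_def m_def)
  next
    have "m - 1 - (card (uminus ` B) - 1) = card A"
      using cB by (simp add: m_def cards)
    then show "v (card (uminus ` B) - 1) \<le> 1"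
      using ge1 by (simp add: v_def inverse_le_1_iff)
  qed (use assms in auto)
  moreover have "uminus ` B - {- j} = uminus ` (B - {j})"
    by auto
  ultimately show ?thesis
    by (simp add: prod.reindex abs_minus_commute)
qed

section \<open>Interpolation with bounded coefficients\<close>

text \<open>Gaussian elimination, one equation at a time.\<close>
lemma homogeneous_system_nontrivial_solution:
  fixes a :: "'x \<Rightarrow> 'e \<Rightarrow> real"
  assumes "finite X" "finite E" "card X < card E"
  shows "\<exists>c. (\<exists>e\<in>E. c e \<noteq> 0) \<and> (\<forall>x\<in>X. (\<Sum>e\<in>E. c e * a x e) = 0)"
  using assms
proof (induction X arbitrary: E a rule: finite_induct)
  case empty
  then obtain e where "e \<in> E" by fastforce
  then show ?case by (intro exI[of _ "\<lambda>_. 1"]) auto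
next
  case (insert x X)
  show ?case
  proof (cases "\<forall>e\<in>E. a x e = 0")
    case True
    obtain c where "\<exists>e\<in>E. c e \<noteq> 0" "\<forall>y\<in>X. (\<Sum>e\<in>E. c e * a y e) = 0"
      using insert.IH[of E a] insert.prems insert.hyps by auto
    then show ?thesis using True by (intro exI[of _ c]) auto
  next
    case False
    then obtain p where p: "p \<in> E" "a x p \<noteq> 0" by blast
    \<comment> \<open>Solve the equation at \<open>x\<close> for the unknown at \<open>p\<close> and substitute it into the others.\<close>
    define b where "b y e = a y e - a y p * a x e / a x p" for y e
    have "card X < card (E - {p})"
      using insert.prems insert.hyps p by simp
    then obtain c where c: "\<exists>e\<in>E - {p}. c e \<noteq> 0"
        "\<forall>y\<in>X. (\<Sum>e\<in>E - {p}. c e * b y e) = 0"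
      using insert.IH[of "E - {p}" b] insert.prems by auto
    define s where "s = (\<Sum>e\<in>E - {p}. c e * a x e)"
    define c' where "c' = c(p := - s / a x p)"
    have sum_c': "(\<Sum>e\<in>E. c' e * a y e) = - s / a x p * a y p + (\<Sum>e\<in>E - {p}. c e * a y e)" for y
      using p insert.prems by (simp add: sum.remove[of E p] c'_def)
    have "(\<Sum>e\<in>E - {p}. c e * b y e) = (\<Sum>e\<in>E. c' e * a y e)" for y
      unfolding sum_c' b_def s_def
      by (simp add: right_diff_distrib sum_subtractf sum_distrib_left sum_distrib_right
          sum_divide_distrib mult_ac)
    moreover have "(\<Sum>e\<in>E. c' e * a x e) = 0"
      using p sum_c'[of x] by (simp add: s_def)
    moreover have "\<exists>e\<in>E. c' e \<noteq> 0"
      using c(1) by (auto simp: c'_def)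
    ultimately show ?thesis
      using c(2) by (intro exI[of _ c']) auto
  qed
qed

text \<open>There are more unknown coefficients than points, so some nontrivial combination of the chosen powers
and \<open>x ^ M\<close> vanishes at all the points. The two coefficient bounds hold for every such combination;
they show that its coefficient at \<open>M\<close> is nonzero, since otherwise all coefficients would vanish, and
then that the normalized combination is bounded.\<close>
lemma bounded_interpolation:
  fixes L U :: "nat set"
  assumes fin: "finite L" "finite U" and card: "n \<le> card L" "n \<le> card U"
    and less: "\<And>e. e \<in> L \<Longrightarrow> e < M" "\<And>e. e \<in> U \<Longrightarrow> M < e"
  shows "\<exists>K\<ge>0. \<forall>X::real set. finite X \<and> X \<subseteq> {0<..} \<and> card X \<le> n \<longrightarrow>
    (\<exists>\<alpha>. (\<forall>e\<in>L \<union> U. \<bar>\<alpha> e\<bar> \<le> K) \<and> (\<forall>x\<in>X. x ^ M = (\<Sum>e\<in>L \<union> U. \<alpha> e * x ^ e)))"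
proof -
  define K where "K = (\<Prod>e\<in>L \<union> U. \<bar>real M - real e\<bar>)"
  \<comment> \<open>Distinct integers differ by at least 1, so the products on the left of the coefficient bounds are
    at least 1, and those on the right are at most \<open>K\<close>.\<close>
  have int_gap: "1 \<le> \<bar>real a - real b\<bar>" if "a \<noteq> b" for a b :: nat
    using that by linarith
  have quotient: "\<bar>s\<bar> \<le> K * \<bar>t\<bar>"
    if "T \<subseteq> L \<union> U" "j \<notin> T"
      and "\<bar>s\<bar> * (\<Prod>a\<in>T. \<bar>real j - real a\<bar>) \<le> \<bar>t\<bar> * (\<Prod>a\<in>T. \<bar>real M - real a\<bar>)"
    for s t :: real and T j
  proof -
    have "\<bar>s\<bar> * 1 \<le> \<bar>s\<bar> * (\<Prod>a\<in>T. \<bar>real j - real a\<bar>)"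
      using that(2) by (intro mult_left_mono prod_ge_1 int_gap) auto
    also have "\<dots> \<le> \<bar>t\<bar> * (\<Prod>a\<in>T. \<bar>real M - real a\<bar>)" by fact
    also have "\<dots> \<le> \<bar>t\<bar> * K"
      unfolding K_def using fin that(1) less
      by (intro mult_left_mono prod_mono2 int_gap) auto
    finally show ?thesis by (simp add: mult.commute)
  qed
  have "\<exists>\<alpha>. (\<forall>e\<in>L \<union> U. \<bar>\<alpha> e\<bar> \<le> K) \<and> (\<forall>x\<in>X. x ^ M = (\<Sum>e\<in>L \<union> U. \<alpha> e * x ^ e))"
    if X: "finite X" "X \<subseteq> {0<..}" "card X \<le> n" for X :: "real set"
  proof -
    \<comment> \<open>As many lower exponents as there are points up to 1, and as many upper ones as there are points
      beyond 1.\<close>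
    define X1 where "X1 = {x\<in>X. x \<le> 1}"
    define X2 where "X2 = {x\<in>X. 1 < x}"
    have X12: "finite X1" "finite X2" "X = X1 \<union> X2" "X1 \<inter> X2 = {}"
      using X(1) by (auto simp: X1_def X2_def)
    then have card_X: "card X = card X1 + card X2"
      by (simp add: card_Un_disjoint)
    obtain A where A: "A \<subseteq> L" "card A = card X1" "finite A"
      using obtain_subset_with_card_n[of "card X1" L] card_X X(3) card by auto
    obtain B where B: "B \<subseteq> U" "card B = card X2" "finite B"
      using obtain_subset_with_card_n[of "card X2" U] card_X X(3) card by auto
    have disj: "A \<inter> B = {}" "M \<notin> A \<union> B"
      using A(1) B(1) less by fastforce+
    have "card X < card (insert M (A \<union> B))"
      using A B disj card_X by (simp add: card_Un_disjoint)
    then obtain c where c: "\<exists>e\<in>insert M (A \<union> B). c e \<noteq> 0"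
      "\<And>x. x \<in> X \<Longrightarrow> (\<Sum>e\<in>insert M (A \<union> B). c e * x ^ e) = 0"
      using homogeneous_system_nontrivial_solution[OF X(1), of "insert M (A \<union> B)" "\<lambda>x e. x ^ e"] A B
      by auto
    \<comment> \<open>The same coefficients, indexed by real exponents.\<close>
    define c' where "c' r = c (nat \<lfloor>r\<rfloor>)" for r :: real
    have exp: "exp_sum c' (insert (real M) (real ` A \<union> real ` B)) x = 0" if "x \<in> X" for x
    proof -
      have "insert (real M) (real ` A \<union> real ` B) = real ` insert M (A \<union> B)" by auto
      moreover have "(\<Sum>r\<in>real ` insert M (A \<union> B). c' r * x powr r)
          = (\<Sum>e\<in>insert M (A \<union> B). c e * x ^ e)"
        using that X(2) by (subst sum.reindex) (auto simp: c'_def powr_realpow intro!: sum.cong)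
      ultimately show ?thesis
        using c(2)[OF that] by (simp add: exp_sum_def)
    qed
    define xs where "xs = sorted_list_of_set X1 @ sorted_list_of_set X2"
    have xs: "set xs = X" "length xs = card X" "sorted_wrt (<) xs"
    proof -
      have "x < y" if "x \<in> X1" "y \<in> X2" for x y
        using that by (simp add: X1_def X2_def)
      then show "sorted_wrt (<) xs"
        using X12(1,2) by (simp add: xs_def sorted_wrt_append)
    qed (use X12 card_X in \<open>simp_all add: xs_def\<close>)
    have cards: "card (real ` A) = card X1" "card (real ` B) = card X2"
      using A B by (simp_all add: card_image)
    have u: "0 < xs ! i \<and> exp_sum c' (insert (real M) (real ` A \<union> real ` B)) (xs ! i) = 0"
      if "i < card (real ` A) + card (real ` B)" for i
    proof -
      have "xs ! i \<in> set xs" using that xs cards card_X by (intro nth_mem) simp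
      then have "xs ! i \<in> X" using xs by simp
      then show ?thesis using exp X(2) by auto
    qed
    have u_less: "xs ! i < xs ! Suc i" if "Suc i < card (real ` A) + card (real ` B)" for i
      using that xs cards card_X by (auto simp: sorted_wrt_iff_nth_less)
    have lower: "\<bar>c j\<bar> \<le> K * \<bar>c M\<bar>" if j: "j \<in> A" for j
    proof -
      have pos: "card X1 > 0" using j A by (auto simp flip: A(2) B(2) simp: card_gt_0_iff)
      then have "sorted_list_of_set X1 ! (card X1 - 1) \<in> set (sorted_list_of_set X1)"
        by (intro nth_mem) simp
      then have "xs ! (card X1 - 1) \<in> X1"
        using X12 pos by (simp add: xs_def nth_append)
      then have "xs ! (card X1 - 1) \<le> 1" by (simp add: X1_def)
      then have "\<bar>c' (real j)\<bar> * (\<Prod>a\<in>real ` A - {real j}. \<bar>real j - a\<bar>)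
          \<le> \<bar>c' (real M)\<bar> * (\<Prod>a\<in>real ` A - {real j}. \<bar>real M - a\<bar>)"
        using u u_less A B less j cards by (intro lower_coeff_bound[where B = "real ` B"]) auto
      moreover have "real ` A - {real j} = real ` (A - {j})" by auto
      ultimately show ?thesis
        using A by (intro quotient[of "A - {j}" j]) (auto simp: c'_def prod.reindex o_def)
    qed
    have upper: "\<bar>c j\<bar> \<le> K * \<bar>c M\<bar>" if j: "j \<in> B" for j
    proof -
      have pos: "card X2 > 0" using j B by (auto simp flip: A(2) B(2) simp: card_gt_0_iff)
      then have "sorted_list_of_set X2 ! 0 \<in> set (sorted_list_of_set X2)"
        by (intro nth_mem) simp
      then have "xs ! card X1 \<in> X2"
        using X12 by (simp add: xs_def nth_append)
      then have "1 \<le> xs ! card X1" by (simp add: X2_def)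
      then have "\<bar>c' (real j)\<bar> * (\<Prod>a\<in>real ` B - {real j}. \<bar>real j - a\<bar>)
          \<le> \<bar>c' (real M)\<bar> * (\<Prod>a\<in>real ` B - {real j}. \<bar>real M - a\<bar>)"
        using u u_less A B less j cards by (intro upper_coeff_bound[where A = "real ` A"]) auto
      moreover have "real ` B - {real j} = real ` (B - {j})" by auto
      ultimately show ?thesis
        using B by (intro quotient[of "B - {j}" j]) (auto simp: c'_def prod.reindex o_def)
    qed
    have cM: "c M \<noteq> 0"
    proof
      assume "c M = 0"
      then have "c e = 0" if "e \<in> insert M (A \<union> B)" for e
        using lower[of e] upper[of e] that by auto
      then show False using c(1) by blast
    qed
    define \<alpha> where "\<alpha> e = (if e \<in> A \<union> B then - c e / c M else 0)" for e
    have "\<bar>\<alpha> e\<bar> \<le> K" for e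
    proof -
      have "0 \<le> K" by (simp add: K_def prod_nonneg)
      then show ?thesis
        using lower[of e] upper[of e] cM by (auto simp: \<alpha>_def divide_le_eq)
    qed
    moreover have "x ^ M = (\<Sum>e\<in>L \<union> U. \<alpha> e * x ^ e)" if "x \<in> X" for x
    proof -
      have "(\<Sum>e\<in>L \<union> U. \<alpha> e * x ^ e) = (\<Sum>e\<in>A \<union> B. \<alpha> e * x ^ e)"
        using A B fin by (intro sum.mono_neutral_right) (auto simp: \<alpha>_def)
      also have "\<dots> = (\<Sum>e\<in>A \<union> B. (- 1 / c M) * (c e * x ^ e))"
        by (intro sum.cong) (auto simp: \<alpha>_def)
      also have "\<dots> = (- 1 / c M) * (\<Sum>e\<in>A \<union> B. c e * x ^ e)"
        by (simp add: sum_distrib_left)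
      also have "(\<Sum>e\<in>A \<union> B. c e * x ^ e) = - c M * x ^ M"
        using c(2)[OF that] A B disj by simp
      finally show ?thesis using cM by simp
    qed
    ultimately show ?thesis by blast
  qed
  moreover have "0 \<le> K" by (simp add: K_def prod_nonneg)
  ultimately show ?thesis by blast
qed

text \<open>The left-hand sum is a combination of the sums on the right with bounded coefficients, by interpolation
at the points \<open>u i\<close>; the Cauchy--Schwarz inequality does the rest. That \<open>\<epsilon>\<close> does not depend on
\<open>u\<close> is the point.\<close>
lemma rank_one_domination:
  fixes L U :: "nat set" and c :: "nat \<Rightarrow> real"
  assumes fin: "finite L" "finite U" and card: "n \<le> card L" "n \<le> card U"
    and less: "\<And>e. e \<in> L \<Longrightarrow> e < M" "\<And>e. e \<in> U \<Longrightarrow> M < e"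
    and c: "\<And>e. e \<in> L \<union> U \<Longrightarrow> 0 < c e"
  shows "\<exists>\<epsilon>>0. \<forall>(I::'i set) u v. finite I \<and> card I \<le> n \<and> (\<forall>i\<in>I. 0 < u i) \<longrightarrow>
    \<epsilon> * (\<Sum>i\<in>I. v i * u i ^ M)\<^sup>2 \<le> (\<Sum>e\<in>L \<union> U. c e * (\<Sum>i\<in>I. v i * u i ^ e)\<^sup>2)"
proof -
  have "\<exists>K\<ge>0. \<forall>X::real set. finite X \<and> X \<subseteq> {0<..} \<and> card X \<le> n \<longrightarrow>
    (\<exists>\<alpha>. (\<forall>e\<in>L \<union> U. \<bar>\<alpha> e\<bar> \<le> K) \<and> (\<forall>x\<in>X. x ^ M = (\<Sum>e\<in>L \<union> U. \<alpha> e * x ^ e)))"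
    by (rule bounded_interpolation) (use fin card less in auto)
  then obtain K where K: "0 \<le> K" and interp: "\<forall>X::real set. finite X \<and> X \<subseteq> {0<..} \<and> card X \<le> n \<longrightarrow>
    (\<exists>\<alpha>. (\<forall>e\<in>L \<union> U. \<bar>\<alpha> e\<bar> \<le> K) \<and> (\<forall>x\<in>X. x ^ M = (\<Sum>e\<in>L \<union> U. \<alpha> e * x ^ e)))"
    by (elim exE conjE)
  define m where "m = Min (insert 1 (c ` (L \<union> U)))"
  have m: "0 < m" "\<And>e. e \<in> L \<union> U \<Longrightarrow> m \<le> c e"
    using fin c by (auto simp: m_def intro!: Min_le)
  define Q where "Q = K\<^sup>2 * card (L \<union> U)"
  have Q: "0 \<le> Q" by (simp add: Q_def)
  have "m / (1 + Q) * (\<Sum>i\<in>I. v i * u i ^ M)\<^sup>2 \<le> (\<Sum>e\<in>L \<union> U. c e * (\<Sum>i\<in>I. v i * u i ^ e)\<^sup>2)"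
    if I: "finite I" "card I \<le> n" "\<forall>i\<in>I. 0 < u i" for I :: "'i set" and u v :: "'i \<Rightarrow> real"
  proof -
    define w where "w e = (\<Sum>i\<in>I. v i * u i ^ e)" for e
    have "card (u ` I) \<le> n" using card_image_le[OF I(1), of u] I(2) by simp
    moreover have "finite (u ` I)" "u ` I \<subseteq> {0<..}" using I by auto
    ultimately have "\<exists>\<alpha>. (\<forall>e\<in>L \<union> U. \<bar>\<alpha> e\<bar> \<le> K) \<and>
        (\<forall>x\<in>u ` I. x ^ M = (\<Sum>e\<in>L \<union> U. \<alpha> e * x ^ e))"
      by (intro interp[rule_format] conjI)
    then obtain \<alpha> where \<alpha>_ball: "\<forall>e\<in>L \<union> U. \<bar>\<alpha> e\<bar> \<le> K"
      "\<forall>x\<in>u ` I. x ^ M = (\<Sum>e\<in>L \<union> U. \<alpha> e * x ^ e)"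
      by (elim exE conjE)
    then have \<alpha>: "\<And>e. e \<in> L \<union> U \<Longrightarrow> \<bar>\<alpha> e\<bar> \<le> K"
      "\<And>i. i \<in> I \<Longrightarrow> u i ^ M = (\<Sum>e\<in>L \<union> U. \<alpha> e * u i ^ e)"
      by simp_all
    have "w M = (\<Sum>i\<in>I. \<Sum>e\<in>L \<union> U. \<alpha> e * (v i * u i ^ e))"
      unfolding w_def by (intro sum.cong) (simp_all add: \<alpha>(2) sum_distrib_left mult_ac)
    also have "\<dots> = (\<Sum>e\<in>L \<union> U. \<alpha> e * w e)"
      unfolding w_def by (subst sum.swap) (simp add: sum_distrib_left)
    finally have "(w M)\<^sup>2 = (\<Sum>e\<in>L \<union> U. \<alpha> e * w e)\<^sup>2" by simp
    also have "\<dots> \<le> (\<Sum>e\<in>L \<union> U. (\<alpha> e)\<^sup>2) * (\<Sum>e\<in>L \<union> U. (w e)\<^sup>2)"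
      by (rule Cauchy_Schwarz_ineq_sum)
    also have "(\<Sum>e\<in>L \<union> U. (\<alpha> e)\<^sup>2) \<le> (\<Sum>e\<in>L \<union> U. K\<^sup>2)"
    proof (rule sum_mono)
      fix e assume "e \<in> L \<union> U"
      then show "(\<alpha> e)\<^sup>2 \<le> K\<^sup>2"
        using power_mono[OF \<alpha>(1), of e 2] by simp
    qed
    also have "(\<Sum>e\<in>L \<union> U. K\<^sup>2) \<le> 1 + Q"
      by (simp add: Q_def mult.commute)
    finally have "(w M)\<^sup>2 \<le> (1 + Q) * (\<Sum>e\<in>L \<union> U. (w e)\<^sup>2)"
      by (simp add: mult_right_mono sum_nonneg)
    then have "m * (w M)\<^sup>2 \<le> m * ((1 + Q) * (\<Sum>e\<in>L \<union> U. (w e)\<^sup>2))"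
      using m(1) by (intro mult_left_mono) auto
    then have "m / (1 + Q) * (w M)\<^sup>2 \<le> m * (\<Sum>e\<in>L \<union> U. (w e)\<^sup>2)"
      using Q by (simp add: divide_le_eq mult_ac)
    also have "\<dots> \<le> (\<Sum>e\<in>L \<union> U. c e * (w e)\<^sup>2)"
      unfolding sum_distrib_left by (intro sum_mono mult_right_mono m(2)) auto
    finally show ?thesis by (simp add: w_def)
  qed
  moreover have "0 < m / (1 + Q)" using m Q by simp
  ultimately show ?thesis by blast
qed

section \<open>Positive semidefinite arrays and the Schur product\<close>

text \<open>Real symmetric matrices are indexed by an arbitrary finite set, so that deleting a row and a column
needs no renumbering.\<close>
definition psd_on :: "'i set \<Rightarrow> ('i \<Rightarrow> 'i \<Rightarrow> real) \<Rightarrow> bool" where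
  "psd_on I A \<longleftrightarrow> (\<forall>i\<in>I. \<forall>j\<in>I. A i j = A j i) \<and>
     (\<forall>v. 0 \<le> (\<Sum>i\<in>I. \<Sum>j\<in>I. v i * A i j * v j))"

lemma psd_on_sym: "psd_on I A \<Longrightarrow> i \<in> I \<Longrightarrow> j \<in> I \<Longrightarrow> A i j = A j i"
  by (simp add: psd_on_def)

lemma psd_on_quadratic: "psd_on I A \<Longrightarrow> 0 \<le> (\<Sum>i\<in>I. \<Sum>j\<in>I. v i * A i j * v j)"
  by (simp add: psd_on_def)

lemma psd_on_add:
  assumes "psd_on I A" "psd_on I B"
  shows "psd_on I (\<lambda>i j. A i j + B i j)"
  using assms by (auto simp: psd_on_def distrib_left distrib_right sum.distrib)

lemma psd_on_scale:
  assumes "psd_on I A" "0 \<le> t"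
  shows "psd_on I (\<lambda>i j. t * A i j)"
proof -
  have "(\<Sum>i\<in>I. \<Sum>j\<in>I. v i * (t * A i j) * v j) = t * (\<Sum>i\<in>I. \<Sum>j\<in>I. v i * A i j * v j)" for v
    by (simp add: sum_distrib_left mult_ac)
  then show ?thesis
    using assms by (auto simp: psd_on_def)
qed

lemma quadratic_rank_one:
  "(\<Sum>i\<in>I. \<Sum>j\<in>I. v i * (z i * z j) * v j) = (\<Sum>i\<in>I. v i * z i)\<^sup>2" for z :: "'i \<Rightarrow> real"
  by (simp add: power2_eq_square sum_product mult_ac)

lemma psd_on_rank_one: "psd_on I (\<lambda>i j. z i * z j)"
  by (simp add: psd_on_def quadratic_rank_one)

lemma quadratic_insert:
  fixes A :: "'i \<Rightarrow> 'i \<Rightarrow> real"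
  assumes "finite I" "k \<notin> I" "\<And>i. i \<in> I \<Longrightarrow> A k i = A i k"
  shows "(\<Sum>i\<in>insert k I. \<Sum>j\<in>insert k I. v i * A i j * v j)
    = A k k * (v k)\<^sup>2 + 2 * v k * (\<Sum>i\<in>I. v i * A i k) + (\<Sum>i\<in>I. \<Sum>j\<in>I. v i * A i j * v j)"
proof -
  have "(\<Sum>j\<in>I. v k * A k j * v j) = v k * (\<Sum>i\<in>I. v i * A i k)"
    by (simp add: sum_distrib_left assms(3) mult_ac)
  moreover have "(\<Sum>i\<in>I. v i * A i k * v k) = v k * (\<Sum>i\<in>I. v i * A i k)"
    by (simp add: sum_distrib_left mult_ac)
  ultimately show ?thesis
    using assms(1,2) by (simp add: sum.distrib power2_eq_square mult_ac)
qed

lemma psd_on_bordered: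
  assumes "finite I" "k \<notin> I" "psd_on (insert k I) A"
  shows "0 \<le> A k k * t\<^sup>2 + 2 * t * (\<Sum>i\<in>I. v i * A i k) + (\<Sum>i\<in>I. \<Sum>j\<in>I. v i * A i j * v j)"
proof -
  have same: "(v(k := t)) i = v i" if "i \<in> I" for i
    using that assms(2) by auto
  have "(\<Sum>i\<in>I. (v(k := t)) i * A i k) = (\<Sum>i\<in>I. v i * A i k)"
    by (intro sum.cong refl) (simp only: same)
  moreover have "(\<Sum>i\<in>I. \<Sum>j\<in>I. (v(k := t)) i * A i j * (v(k := t)) j)
      = (\<Sum>i\<in>I. \<Sum>j\<in>I. v i * A i j * v j)"
    by (intro sum.cong refl) (simp only: same)
  moreover have "(\<Sum>i\<in>insert k I. \<Sum>j\<in>insert k I. (v(k := t)) i * A i j * (v(k := t)) j)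
    = A k k * ((v(k := t)) k)\<^sup>2 + 2 * (v(k := t)) k * (\<Sum>i\<in>I. (v(k := t)) i * A i k)
      + (\<Sum>i\<in>I. \<Sum>j\<in>I. (v(k := t)) i * A i j * (v(k := t)) j)"
    using assms psd_on_sym[OF assms(3)] by (intro quadratic_insert) auto
  ultimately show ?thesis
    using psd_on_quadratic[OF assms(3), of "v(k := t)"] by simp
qed

lemma psd_on_diag_nonneg:
  assumes "finite I" "k \<notin> I" "psd_on (insert k I) A"
  shows "0 \<le> A k k"
  using psd_on_bordered[OF assms, of 1 "\<lambda>_. 0"] by simp

lemma psd_on_zero_diag:
  assumes "finite I" "k \<notin> I" "psd_on (insert k I) A" "A k k = 0" "i \<in> I"
  shows "A i k = 0"
proof (rule ccontr)
  assume nz: "A i k \<noteq> 0"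
  define v where "v j = (if j = i then 1 else 0 :: real)" for j
  define Q where "Q = (\<Sum>i\<in>I. \<Sum>j\<in>I. v i * A i j * v j)"
  have "(\<Sum>j\<in>I. v j * A j k) = A i k"
  proof -
    have "(\<Sum>j\<in>I. v j * A j k) = (\<Sum>j\<in>I. if j = i then A j k else 0)"
      by (intro sum.cong) (auto simp: v_def)
    then show ?thesis using assms(1,5) by simp
  qed
  then have "0 \<le> 2 * t * A i k + Q" for t
    using psd_on_bordered[OF assms(1-3), of t v] assms(4) by (simp add: Q_def)
  from this[of "- (Q + 1) / (2 * A i k)"] show False
    using nz by (simp add: field_simps)
qed

text \<open>The rank-one matrix \<open>pivot A k i * pivot A k j\<close> agrees with \<open>A\<close> in row and column \<open>k\<close>. If \<open>A\<close> is positive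
semidefinite and \<open>A k k = 0\<close>, then column \<open>k\<close> of \<open>A\<close> vanishes, and division by 0 yields the right value 0.\<close>
definition pivot :: "('i \<Rightarrow> 'i \<Rightarrow> real) \<Rightarrow> 'i \<Rightarrow> 'i \<Rightarrow> real" where
  "pivot A k i = A i k / sqrt (A k k)"

lemma psd_on_pivot:
  assumes "finite I" "k \<notin> I" "psd_on (insert k I) A" "i \<in> insert k I"
  shows "pivot A k i * pivot A k k = A i k"
proof (cases "A k k = 0")
  case True
  then show ?thesis
    using psd_on_zero_diag[OF assms(1-3)] assms(4) by (auto simp: pivot_def)
next
  case False
  then show ?thesis
    using psd_on_diag_nonneg[OF assms(1-3)] by (simp add: pivot_def)
qed

text \<open>The quadratic form of the complement at \<open>v\<close> is the minimum of that of \<open>A\<close> over all extensions of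
\<open>v\<close> by a value \<open>t\<close> at \<open>k\<close>; if \<open>A k k > 0\<close>, it is attained at \<open>t = - b / A k k\<close>.\<close>
lemma psd_on_schur_complement:
  assumes "finite I" "k \<notin> I" "psd_on (insert k I) A"
  shows "psd_on I (\<lambda>i j. A i j - pivot A k i * pivot A k j)"
  unfolding psd_on_def
proof (intro conjI ballI allI)
  show "A i j - pivot A k i * pivot A k j = A j i - pivot A k j * pivot A k i"
    if "i \<in> I" "j \<in> I" for i j
    using psd_on_sym[OF assms(3)] that by simp
  fix v
  define b where "b = (\<Sum>i\<in>I. v i * A i k)"
  define Q where "Q = (\<Sum>i\<in>I. \<Sum>j\<in>I. v i * A i j * v j)"
  have quad: "0 \<le> A k k * t\<^sup>2 + 2 * t * b + Q" for t
    unfolding b_def Q_def by (rule psd_on_bordered[OF assms])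
  have "(\<Sum>i\<in>I. \<Sum>j\<in>I. v i * (A i j - pivot A k i * pivot A k j) * v j)
      = Q - (\<Sum>i\<in>I. \<Sum>j\<in>I. v i * (pivot A k i * pivot A k j) * v j)"
    by (simp add: Q_def right_diff_distrib left_diff_distrib sum_subtractf)
  also have "\<dots> = Q - (\<Sum>i\<in>I. v i * pivot A k i)\<^sup>2"
    by (simp only: quadratic_rank_one)
  also have "(\<Sum>i\<in>I. v i * pivot A k i) = b / sqrt (A k k)"
    by (simp add: pivot_def b_def sum_divide_distrib)
  also have "(b / sqrt (A k k))\<^sup>2 = b\<^sup>2 / A k k"
    using psd_on_diag_nonneg[OF assms] by (simp add: power_divide)
  also have "0 \<le> Q - b\<^sup>2 / A k k"
  proof (cases "A k k = 0")
    case True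
    then show ?thesis using quad[of 0] by simp
  next
    case False
    then show ?thesis
      using quad[of "- b / A k k"] by (simp add: power2_eq_square field_simps)
  qed
  finally show "0 \<le> (\<Sum>i\<in>I. \<Sum>j\<in>I. v i * (A i j - pivot A k i * pivot A k j) * v j)" .
qed

lemma quadratic_pivot_vanishing:
  assumes "finite I" "k \<notin> I" "psd_on (insert k I) A"
  shows "(\<Sum>i\<in>insert k I. \<Sum>j\<in>insert k I.
      v i * ((A i j - pivot A k i * pivot A k j) * B i j) * v j)
    = (\<Sum>i\<in>I. \<Sum>j\<in>I. v i * ((A i j - pivot A k i * pivot A k j) * B i j) * v j)"
proof -
  have z: "A i k - pivot A k i * pivot A k k = 0" "A k i - pivot A k k * pivot A k i = 0"
    if "i \<in> insert k I" for i
    using psd_on_pivot[OF assms that] psd_on_sym[OF assms(3) that, of k]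
    by (simp_all add: mult.commute)
  show ?thesis
    using assms(1,2) z by simp
qed

text \<open>Split \<open>A\<close> into its pivot part \<open>z i * z j\<close> and the Schur complement. The product of \<open>z i * z j\<close> with
\<open>B\<close> has at \<open>v\<close> the quadratic form of \<open>B\<close> at the vector with entries \<open>v i * z i\<close>, and the product of
the complement with \<open>B\<close> lives on the smaller index set.\<close>
theorem schur_product:
  assumes "finite I" "psd_on I A" "psd_on I B"
  shows "psd_on I (\<lambda>i j. A i j * B i j)"
  using assms
proof (induction I arbitrary: A rule: finite_induct)
  case empty
  then show ?case by (simp add: psd_on_def)
next
  case (insert k I)
  note fact = insert.hyps insert.prems(1)
  let ?z = "pivot A k"
  have B_I: "psd_on I B"
  proof -
    have "0 \<le> (\<Sum>i\<in>I. \<Sum>j\<in>I. v i * B i j * v j)" for v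
      using psd_on_bordered[OF insert.hyps insert.prems(2), of 0 v] by simp
    then show ?thesis using insert.prems(2) by (auto simp: psd_on_def)
  qed
  have "0 \<le> (\<Sum>i\<in>insert k I. \<Sum>j\<in>insert k I. v i * (A i j * B i j) * v j)" for v
  proof -
    have "0 \<le> (\<Sum>i\<in>insert k I. \<Sum>j\<in>insert k I. (v i * ?z i) * B i j * (v j * ?z j))"
      by (rule psd_on_quadratic[OF insert.prems(2)])
    moreover have "0 \<le> (\<Sum>i\<in>insert k I. \<Sum>j\<in>insert k I. v i * ((A i j - ?z i * ?z j) * B i j) * v j)"
      unfolding quadratic_pivot_vanishing[OF fact]
      by (rule psd_on_quadratic[OF insert.IH[OF psd_on_schur_complement[OF fact] B_I]])
    ultimately have "0 \<le> (\<Sum>i\<in>insert k I. \<Sum>j\<in>insert k I.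
        (v i * ?z i) * B i j * (v j * ?z j) + v i * ((A i j - ?z i * ?z j) * B i j) * v j)"
      by (simp only: sum.distrib)
    also have "\<dots> = (\<Sum>i\<in>insert k I. \<Sum>j\<in>insert k I. v i * (A i j * B i j) * v j)"
      by (intro sum.cong refl) (simp add: algebra_simps)
    finally show ?thesis .
  qed
  then show ?case
    using psd_on_sym[OF insert.prems(1)] psd_on_sym[OF insert.prems(2)]
    unfolding psd_on_def by (metis (no_types, lifting))
qed

section \<open>From rank one to all positive semidefinite matrices\<close>

text \<open>The extension principle of FitzGerald and Horn. On the segment from the rank-one matrix \<open>z i * z j\<close>,
with \<open>z\<close> the pivot of \<open>A\<close>, to \<open>A\<close> itself, the quadratic form of the entrywise image is nondecreasing:
its derivative only involves the indices in \<open>I\<close>, because the direction \<open>D\<close> of the segment vanishes at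
\<open>k\<close>, and is nonnegative by the Schur product theorem.\<close>
theorem entrywise_psd_by_derivative:
  fixes f f' :: "real \<Rightarrow> real"
  assumes I: "finite I" "k \<notin> I"
    and deriv: "\<And>x. 0 < x \<Longrightarrow> (f has_real_derivative f' x) (at x)"
    and f'_psd: "\<And>B. psd_on I B \<Longrightarrow> (\<And>i j. i \<in> I \<Longrightarrow> j \<in> I \<Longrightarrow> 0 < B i j) \<Longrightarrow>
        psd_on I (\<lambda>i j. f' (B i j))"
    and rank_one: "\<And>u. (\<And>i. i \<in> insert k I \<Longrightarrow> 0 < u i) \<Longrightarrow>
        psd_on (insert k I) (\<lambda>i j. f (u i * u j))"
    and A: "psd_on (insert k I) A" "\<And>i j. i \<in> insert k I \<Longrightarrow> j \<in> insert k I \<Longrightarrow> 0 < A i j"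
  shows "psd_on (insert k I) (\<lambda>i j. f (A i j))"
  unfolding psd_on_def
proof (intro conjI ballI allI)
  show "f (A i j) = f (A j i)" if "i \<in> insert k I" "j \<in> insert k I" for i j
    using psd_on_sym[OF A(1) that] by simp
  fix v
  define z where "z = pivot A k"
  define D where "D i j = A i j - z i * z j" for i j
  define S where "S t i j = z i * z j + t * D i j" for t i j
  have z: "0 < z i" if "i \<in> insert k I" for i
    using A(2) that by (simp add: z_def pivot_def)
  \<comment> \<open>The segment consists of convex combinations of two matrices with positive entries.\<close>
  have S_pos: "0 < S t i j" if "0 \<le> t" "t \<le> 1" "i \<in> insert k I" "j \<in> insert k I" for t i j
  proof (cases "t = 1")
    case True
    then show ?thesis using A(2) that by (simp add: S_def D_def)
  next
    case False
    have "S t i j = (1 - t) * (z i * z j) + t * A i j"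
      by (simp add: S_def D_def algebra_simps)
    moreover have "0 < (1 - t) * (z i * z j)" "0 \<le> t * A i j"
      using False that z A(2)[of i j] by (auto intro!: mult_pos_pos mult_nonneg_nonneg simp: less_imp_le)
    ultimately show ?thesis by simp
  qed
  have D_psd: "psd_on I D"
    unfolding D_def z_def by (rule psd_on_schur_complement[OF I A(1)])
  have S_psd: "psd_on I (S t)" if "0 \<le> t" for t
    unfolding S_def using that by (intro psd_on_add psd_on_rank_one psd_on_scale D_psd)
  define \<phi> where "\<phi> t = (\<Sum>i\<in>insert k I. \<Sum>j\<in>insert k I. v i * f (S t i j) * v j)" for t
  have "\<phi> 0 \<le> \<phi> 1"
  proof (rule DERIV_nonneg_imp_nondecreasing[where f = \<phi> and a = 0 and b = 1])
    fix t :: real assume t: "0 \<le> t" "t \<le> 1"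
    have "((\<lambda>t. v i * f (S t i j) * v j) has_real_derivative v i * (D i j * f' (S t i j)) * v j) (at t)"
      if "i \<in> insert k I" "j \<in> insert k I" for i j
    proof -
      have "((\<lambda>t. S t i j) has_real_derivative D i j) (at t)"
        unfolding S_def by (auto intro!: derivative_eq_intros)
      then have "((\<lambda>t. f (S t i j)) has_real_derivative f' (S t i j) * D i j) (at t)"
        by (rule DERIV_chain2[where f = f and g = "\<lambda>t. S t i j", OF deriv[OF S_pos[OF t that]]])
      then have "((\<lambda>t. v i * f (S t i j) * v j) has_real_derivative v i * (f' (S t i j) * D i j) * v j) (at t)"
        by (intro DERIV_cmult DERIV_cmult_right)
      then show ?thesis by (simp add: mult.commute)
    qed
    then have "(\<phi> has_real_derivative
        (\<Sum>i\<in>insert k I. \<Sum>j\<in>insert k I. v i * (D i j * f' (S t i j)) * v j)) (at t)"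
      unfolding \<phi>_def by (intro DERIV_sum)
    moreover have "(\<Sum>i\<in>insert k I. \<Sum>j\<in>insert k I. v i * (D i j * f' (S t i j)) * v j)
        = (\<Sum>i\<in>I. \<Sum>j\<in>I. v i * (D i j * f' (S t i j)) * v j)"
      unfolding D_def z_def by (rule quadratic_pivot_vanishing[OF I A(1)])
    moreover have "0 \<le> (\<Sum>i\<in>I. \<Sum>j\<in>I. v i * (D i j * f' (S t i j)) * v j)"
      using t S_pos by (intro psd_on_quadratic schur_product I D_psd f'_psd S_psd) auto
    ultimately show "\<exists>y. (\<phi> has_real_derivative y) (at t) \<and> 0 \<le> y"
      by auto
  qed simp
  moreover have "0 \<le> \<phi> 0"
  proof -
    have "psd_on (insert k I) (\<lambda>i j. f (z i * z j))"
      by (rule rank_one) (rule z)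
    from psd_on_quadratic[OF this, of v] show ?thesis
      by (simp only: \<phi>_def S_def mult_zero_left add_0_right)
  qed
  ultimately have "0 \<le> \<phi> 1" by linarith
  then show "0 \<le> (\<Sum>i\<in>insert k I. \<Sum>j\<in>insert k I. v i * f (A i j) * v j)"
    by (simp add: \<phi>_def S_def D_def)
qed

text \<open>This describes the exponents left after differentiation: each is lowered by one, and a constant term
disappears.\<close>
lemma sum_Suc_shift:
  fixes g :: "nat \<Rightarrow> real"
  assumes "finite E" "g 0 = 0"
  shows "sum g E = (\<Sum>e | Suc e \<in> E. g (Suc e))"
proof -
  have "sum g E = sum g (E - {0})"
    using assms by (intro sum.mono_neutral_right) auto
  also have "E - {0} = Suc ` {e. Suc e \<in> E}"
    by (auto simp: image_iff) (metis not0_implies_Suc)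
  finally show ?thesis
    by (simp add: sum.reindex)
qed

lemma finite_Suc_preimage: "finite E \<Longrightarrow> finite {e. Suc e \<in> E}"
  using finite_vimageI[of E Suc] by (simp add: vimage_def)

lemma card_Suc_preimage:
  assumes "finite E" "Suc n \<le> card E"
  shows "n \<le> card {e. Suc e \<in> E}"
proof -
  have "Suc ` {e. Suc e \<in> E} = E - {0}"
    by (auto simp: image_iff) (metis not0_implies_Suc)
  then have "card {e. Suc e \<in> E} = card (E - {0})"
    by (metis card_image inj_Suc)
  moreover have "card E - 1 \<le> card (E - {0})"
    by (simp add: card_Diff_singleton_if)
  ultimately show ?thesis
    using assms(2) by linarith
qed

text \<open>Differentiation costs at most one lower exponent, namely 0, and no upper one, so the derivative meets
the hypotheses in one dimension less. The induction needs all \<open>\<delta>\<close> up to \<open>\<epsilon>\<close>, since \<open>\<epsilon>\<close> has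
to work both for the derivative, where \<open>\<delta>\<close> turns into \<open>\<delta> * M\<close>, and for the matrices of rank one.\<close>
theorem entrywise_polynomial_psd:
  fixes L U :: "nat set" and c :: "nat \<Rightarrow> real"
  assumes "finite L" "finite U" "n \<le> card L" "n \<le> card U"
    and "\<And>e. e \<in> L \<Longrightarrow> e < M" "\<And>e. e \<in> U \<Longrightarrow> M < e"
    and "\<And>e. e \<in> L \<union> U \<Longrightarrow> 0 < c e"
  shows "\<exists>\<epsilon>>0. \<forall>\<delta> (I::'i set) A. 0 \<le> \<delta> \<and> \<delta> \<le> \<epsilon> \<and> finite I \<and> card I = n \<and> psd_on I A \<and>
    (\<forall>i\<in>I. \<forall>j\<in>I. 0 < A i j) \<longrightarrow>
    psd_on I (\<lambda>i j. (\<Sum>e\<in>L \<union> U. c e * A i j ^ e) - \<delta> * A i j ^ M)"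
  using assms
proof (induction n arbitrary: L U M c)
  case 0
  then show ?case
    by (intro exI[of _ 1]) (auto simp: psd_on_def)
next
  case (Suc n)
  define L' where "L' = {e. Suc e \<in> L}"
  define U' where "U' = {e. Suc e \<in> U}"
  have "L \<noteq> {}" using Suc.prems(3) by auto
  then obtain M' where M: "M = Suc M'"
    using Suc.prems(5) by (metis ex_in_conv not_less_zero not0_implies_Suc)
  have "\<exists>\<epsilon>>0. \<forall>\<delta> (I::'i set) A. 0 \<le> \<delta> \<and> \<delta> \<le> \<epsilon> \<and> finite I \<and> card I = n \<and> psd_on I A \<and>
    (\<forall>i\<in>I. \<forall>j\<in>I. 0 < A i j) \<longrightarrow>
    psd_on I (\<lambda>i j. (\<Sum>e\<in>L' \<union> U'. (c (Suc e) * Suc e) * A i j ^ e) - \<delta> * A i j ^ M')"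
  proof (rule Suc.IH)
    show "finite L'" "finite U'" "n \<le> card L'" "n \<le> card U'"
      using Suc.prems(1-4) by (simp_all add: L'_def U'_def finite_Suc_preimage card_Suc_preimage)
    show "e < M'" if "e \<in> L'" for e
      using that Suc.prems(5)[of "Suc e"] M by (simp add: L'_def)
    show "M' < e" if "e \<in> U'" for e
      using that Suc.prems(6)[of "Suc e"] M by (simp add: U'_def)
    show "0 < c (Suc e) * real (Suc e)" if "e \<in> L' \<union> U'" for e
      using that Suc.prems(7)[of "Suc e"] by (auto simp: L'_def U'_def)
  qed
  then obtain \<epsilon>1 where \<epsilon>1: "\<epsilon>1 > 0" "\<forall>\<delta> (I::'i set) A. 0 \<le> \<delta> \<and> \<delta> \<le> \<epsilon>1 \<and> finite I \<and> card I = n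
    \<and> psd_on I A \<and> (\<forall>i\<in>I. \<forall>j\<in>I. 0 < A i j) \<longrightarrow>
    psd_on I (\<lambda>i j. (\<Sum>e\<in>L' \<union> U'. (c (Suc e) * Suc e) * A i j ^ e) - \<delta> * A i j ^ M')"
    by (elim exE conjE)
  have "\<exists>\<epsilon>>0. \<forall>(I::'i set) u v. finite I \<and> card I \<le> Suc n \<and> (\<forall>i\<in>I. 0 < u i) \<longrightarrow>
    \<epsilon> * (\<Sum>i\<in>I. v i * u i ^ M)\<^sup>2 \<le> (\<Sum>e\<in>L \<union> U. c e * (\<Sum>i\<in>I. v i * u i ^ e)\<^sup>2)"
    by (rule rank_one_domination) (use Suc.prems in auto)
  then obtain \<epsilon>2 where \<epsilon>2: "\<epsilon>2 > 0" "\<forall>(I::'i set) u v. finite I \<and> card I \<le> Suc n \<and> (\<forall>i\<in>I. 0 < u i) \<longrightarrow>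
    \<epsilon>2 * (\<Sum>i\<in>I. v i * u i ^ M)\<^sup>2 \<le> (\<Sum>e\<in>L \<union> U. c e * (\<Sum>i\<in>I. v i * u i ^ e)\<^sup>2)"
    by (elim exE conjE)
  define \<epsilon> where "\<epsilon> = min (\<epsilon>1 / real M) \<epsilon>2"
  have "0 < \<epsilon>" using \<epsilon>1(1) \<epsilon>2(1) M by (simp add: \<epsilon>_def)
  have "psd_on I (\<lambda>i j. (\<Sum>e\<in>L \<union> U. c e * A i j ^ e) - \<delta> * A i j ^ M)"
    if \<delta>: "0 \<le> \<delta>" "\<delta> \<le> \<epsilon>" and I: "finite I" "card I = Suc n"
      and A: "psd_on I A" "\<forall>i\<in>I. \<forall>j\<in>I. 0 < A i j" for \<delta> and I :: "'i set" and A
  proof -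
    obtain k J where J: "I = insert k J" "k \<notin> J" "card J = n" "finite J"
      using I by (metis card_Suc_eq finite_insert)
    define f where "f x = (\<Sum>e\<in>L \<union> U. c e * x ^ e) - \<delta> * x ^ M" for x :: real
    define f' where "f' x = (\<Sum>e\<in>L' \<union> U'. (c (Suc e) * real (Suc e)) * x ^ e) - (\<delta> * real M) * x ^ M'" for x :: real
    have "psd_on (insert k J) (\<lambda>i j. f (A i j))"
    proof (rule entrywise_psd_by_derivative[where f = f and f' = f', OF J(4,2)])
      fix x :: real
      have "(f has_real_derivative (\<Sum>e\<in>L \<union> U. c e * (real e * x ^ (e - 1))) - \<delta> * (real M * x ^ (M - 1))) (at x)"
        unfolding f_def by (auto intro!: derivative_eq_intros sum.cong)
      also have "(\<Sum>e\<in>L \<union> U. c e * (real e * x ^ (e - 1))) = (\<Sum>e\<in>L' \<union> U'. (c (Suc e) * real (Suc e)) * x ^ e)"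
      proof -
        have "{e. Suc e \<in> L \<union> U} = L' \<union> U'" by (auto simp: L'_def U'_def)
        then show ?thesis
          using Suc.prems(1,2) by (subst sum_Suc_shift) (auto simp: mult.assoc)
      qed
      also have "\<dots> - \<delta> * (real M * x ^ (M - 1)) = f' x"
        by (simp add: f'_def M mult.assoc)
      finally show "(f has_real_derivative f' x) (at x)" .
    next
      fix B :: "'i \<Rightarrow> 'i \<Rightarrow> real"
      assume "psd_on J B" "\<And>i j. i \<in> J \<Longrightarrow> j \<in> J \<Longrightarrow> 0 < B i j"
      moreover have "0 \<le> \<delta> * real M" "\<delta> * real M \<le> \<epsilon>1"
        using \<delta> M by (simp_all add: \<epsilon>_def pos_le_divide_eq)
      ultimately show "psd_on J (\<lambda>i j. f' (B i j))"
        using J \<epsilon>1(2) unfolding f'_def by blast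
    next
      fix u :: "'i \<Rightarrow> real"
      assume u: "\<And>i. i \<in> insert k J \<Longrightarrow> 0 < u i"
      have "0 \<le> (\<Sum>i\<in>I. \<Sum>j\<in>I. v i * f (u i * u j) * v j)" for v
      proof -
        have monom: "(\<Sum>i\<in>I. \<Sum>j\<in>I. v i * (u i * u j) ^ e * v j) = (\<Sum>i\<in>I. v i * u i ^ e)\<^sup>2" for e
          by (simp add: power_mult_distrib quadratic_rank_one)
        have "(\<Sum>i\<in>I. \<Sum>j\<in>I. v i * f (u i * u j) * v j)
          = (\<Sum>i\<in>I. \<Sum>j\<in>I. \<Sum>e\<in>L \<union> U. c e * (v i * (u i * u j) ^ e * v j))
            - (\<Sum>i\<in>I. \<Sum>j\<in>I. \<delta> * (v i * (u i * u j) ^ M * v j))"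
          unfolding f_def sum_subtractf[symmetric]
          by (intro sum.cong refl) (simp add: algebra_simps sum_distrib_left)
        also have "(\<Sum>i\<in>I. \<Sum>j\<in>I. \<Sum>e\<in>L \<union> U. c e * (v i * (u i * u j) ^ e * v j))
          = (\<Sum>e\<in>L \<union> U. \<Sum>i\<in>I. \<Sum>j\<in>I. c e * (v i * (u i * u j) ^ e * v j))"
          by (subst sum.swap[of _ "L \<union> U"]) (intro sum.cong refl sum.swap)
        also have "\<dots> = (\<Sum>e\<in>L \<union> U. c e * (\<Sum>i\<in>I. v i * u i ^ e)\<^sup>2)"
          by (simp only: monom flip: sum_distrib_left)
        also have "(\<Sum>i\<in>I. \<Sum>j\<in>I. \<delta> * (v i * (u i * u j) ^ M * v j)) = \<delta> * (\<Sum>i\<in>I. v i * u i ^ M)\<^sup>2"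
          by (simp only: monom flip: sum_distrib_left)
        finally have eq: "(\<Sum>i\<in>I. \<Sum>j\<in>I. v i * f (u i * u j) * v j)
          = (\<Sum>e\<in>L \<union> U. c e * (\<Sum>i\<in>I. v i * u i ^ e)\<^sup>2) - \<delta> * (\<Sum>i\<in>I. v i * u i ^ M)\<^sup>2" .
        have "\<epsilon>2 * (\<Sum>i\<in>I. v i * u i ^ M)\<^sup>2 \<le> (\<Sum>e\<in>L \<union> U. c e * (\<Sum>i\<in>I. v i * u i ^ e)\<^sup>2)"
          using I u J(1) by (intro \<epsilon>2(2)[rule_format]) auto
        moreover have "\<delta> * (\<Sum>i\<in>I. v i * u i ^ M)\<^sup>2 \<le> \<epsilon>2 * (\<Sum>i\<in>I. v i * u i ^ M)\<^sup>2"
          using \<delta> by (intro mult_right_mono) (auto simp: \<epsilon>_def)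
        ultimately show ?thesis
          unfolding eq by linarith
      qed
      then show "psd_on (insert k J) (\<lambda>i j. f (u i * u j))"
        unfolding J(1)[symmetric] by (simp add: psd_on_def mult.commute)
    qed (use A J in auto)
    then show ?thesis
      by (simp add: f_def J(1))
  qed
  then show ?case
    using \<open>0 < \<epsilon>\<close> by blast
qed

section \<open>Complex matrices with real entries\<close>

lemma hermitian_mat_of_real_iff:
  assumes A: "A \<in> carrier_mat N N"
    and a: "\<And>i j. i < N \<Longrightarrow> j < N \<Longrightarrow> A $$ (i, j) = complex_of_real (a i j)"
  shows "hermitian_mat A \<longleftrightarrow> (\<forall>i<N. \<forall>j<N. a i j = a j i)"
proof -
  have adj: "mat_adjoint A \<in> carrier_mat N N"
    "\<And>i j. i < N \<Longrightarrow> j < N \<Longrightarrow> mat_adjoint A $$ (i, j) = complex_of_real (a j i)"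
    using A a by (auto simp: mat_adjoint_def mat_of_rows_def)
  have "mat_adjoint A = A \<longleftrightarrow> (\<forall>i<N. \<forall>j<N. a j i = a i j)"
  proof
    assume "mat_adjoint A = A"
    then show "\<forall>i<N. \<forall>j<N. a j i = a i j"
      using adj(2) a by (metis of_real_eq_iff)
  next
    assume *: "\<forall>i<N. \<forall>j<N. a j i = a i j"
    show "mat_adjoint A = A"
      by (rule eq_matI) (use A adj a * in auto)
  qed
  then show ?thesis
    using A by (auto simp: hermitian_mat_def)
qed

lemma cscalar_prod_mult_mat_vec:
  assumes A: "A \<in> carrier_mat N N" and v: "v \<in> carrier_vec N"
  shows "(A *\<^sub>v v) \<bullet>c v = (\<Sum>i<N. \<Sum>j<N. A $$ (i, j) * v $ j * cnj (v $ i))"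
  using assms by (simp add: scalar_prod_def sum_distrib_right lessThan_atLeast0)

text \<open>For real symmetric \<open>a\<close>, the form at \<open>x + \<i> y\<close> is the sum of the forms at \<open>x\<close> and at \<open>y\<close>, because
the mixed terms cancel.\<close>
lemma positive_semidefinite_of_real_iff:
  assumes A: "A \<in> carrier_mat N N"
    and a: "\<And>i j. i < N \<Longrightarrow> j < N \<Longrightarrow> A $$ (i, j) = complex_of_real (a i j)"
  shows "positive_semidefinite A \<longleftrightarrow> psd_on {..<N} a"
proof -
  have quad: "(A *\<^sub>v v) \<bullet>c v = (\<Sum>i<N. \<Sum>j<N. complex_of_real (a i j) * v $ j * cnj (v $ i))"
    if "v \<in> carrier_vec N" for v
    unfolding cscalar_prod_mult_mat_vec[OF A that] using a by (intro sum.cong) auto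
  show ?thesis
  proof
    assume psd: "positive_semidefinite A"
    have "0 \<le> (\<Sum>i<N. \<Sum>j<N. x i * a i j * x j)" for x
    proof -
      define v where "v = vec N (\<lambda>i. complex_of_real (x i))"
      have v: "v \<in> carrier_vec N" by (simp add: v_def)
      have "0 \<le> (A *\<^sub>v v) \<bullet>c v"
        using psd v A by (simp add: positive_semidefinite_def)
      also have "(A *\<^sub>v v) \<bullet>c v = complex_of_real (\<Sum>i<N. \<Sum>j<N. x i * a i j * x j)"
        unfolding quad[OF v] of_real_sum by (intro sum.cong) (auto simp: v_def)
      finally show ?thesis by (simp add: less_eq_complex_def)
    qed
    then show "psd_on {..<N} a"
      using psd A hermitian_mat_of_real_iff[OF A a]
      by (auto simp: psd_on_def positive_semidefinite_def)
  next
    assume psd: "psd_on {..<N} a"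
    have "0 \<le> (A *\<^sub>v v) \<bullet>c v" if v: "v \<in> carrier_vec N" for v
    proof -
      define x where "x i = Re (v $ i)" for i
      define y where "y i = Im (v $ i)" for i
      have "Re ((A *\<^sub>v v) \<bullet>c v) = (\<Sum>i<N. \<Sum>j<N. x i * a i j * x j) + (\<Sum>i<N. \<Sum>j<N. y i * a i j * y j)"
        unfolding quad[OF v] Re_sum sum.distrib[symmetric] x_def y_def
        by (intro sum.cong refl) (simp add: algebra_simps)
      moreover have "Im ((A *\<^sub>v v) \<bullet>c v) = (\<Sum>i<N. \<Sum>j<N. x i * a i j * y j) - (\<Sum>i<N. \<Sum>j<N. y i * a i j * x j)"
        unfolding quad[OF v] Im_sum sum_subtractf[symmetric] x_def y_def
        by (intro sum.cong refl) (simp add: algebra_simps)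
      moreover have "(\<Sum>i<N. \<Sum>j<N. y i * a i j * x j) = (\<Sum>i<N. \<Sum>j<N. x i * a i j * y j)"
        using psd_on_sym[OF psd]
        by (subst sum.swap) (intro sum.cong refl, simp add: mult_ac)
      ultimately show ?thesis
        using psd_on_quadratic[OF psd] by (simp add: less_eq_complex_def)
    qed
    moreover have "hermitian_mat A"
      using hermitian_mat_of_real_iff[OF A a] psd_on_sym[OF psd] by auto
    ultimately show "positive_semidefinite A"
      using A by (simp add: positive_semidefinite_def)
  qed
qed

section \<open>Preservers with a negative coefficient\<close>

theorem theorem1p10:
  fixes N M :: nat and n :: "nat \<Rightarrow> nat" and c :: "nat \<Rightarrow> real"
  assumes "N > 0"
    and "strict_mono_on {..<2 * N} n"
    and "n (N - 1) < M" and "M < n N"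
    and "\<And>j. j < 2 * N \<Longrightarrow> c (n j) > 0"
  shows "\<exists>cM :: real. cM < 0 \<and>
    entrywise_preserves_positivity N (complex_of_real ` {0<..})
      (\<lambda>x. (\<Sum>j<N. complex_of_real (c (n j)) * x ^ n j)
         + complex_of_real cM * x ^ M
         + (\<Sum>j=N..<2 * N. complex_of_real (c (n j)) * x ^ n j))"
proof -
  define L where "L = n ` {..<N}"
  define U where "U = n ` {N..<2 * N}"
  have inj: "inj_on n {..<2 * N}"
    by (rule strict_mono_on_imp_inj_on[OF assms(2)])
  have inj_L: "inj_on n {..<N}" and inj_U: "inj_on n {N..<2 * N}"
    by (auto intro: inj_on_subset[OF inj])
  have n_mono: "n i \<le> n j" if "i \<le> j" "j < 2 * N" for i j
    using strict_mono_onD[OF assms(2), of i j] that by (cases "i = j") auto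
  have less_L: "e < M" if "e \<in> L" for e
  proof -
    obtain j where "j < N" "e = n j" using \<open>e \<in> L\<close> by (auto simp: L_def)
    moreover have "n j \<le> n (N - 1)" using \<open>j < N\<close> by (intro n_mono) auto
    ultimately show ?thesis using assms(3) by simp
  qed
  have less_U: "M < e" if "e \<in> U" for e
  proof -
    obtain j where "N \<le> j" "j < 2 * N" "e = n j" using \<open>e \<in> U\<close> by (auto simp: U_def)
    then show ?thesis using n_mono[of N j] assms(4) by simp
  qed
  have card_LU: "card L = N" "card U = N"
    by (simp_all add: L_def U_def card_image inj_L inj_U)
  have "\<exists>\<epsilon>>0. \<forall>\<delta> (I::nat set) A. 0 \<le> \<delta> \<and> \<delta> \<le> \<epsilon> \<and> finite I \<and> card I = N \<and> psd_on I A \<and>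
    (\<forall>i\<in>I. \<forall>j\<in>I. 0 < A i j) \<longrightarrow>
    psd_on I (\<lambda>i j. (\<Sum>e\<in>L \<union> U. c e * A i j ^ e) - \<delta> * A i j ^ M)"
    by (rule entrywise_polynomial_psd) (use card_LU less_L less_U assms(5) in \<open>auto simp: L_def U_def\<close>)
  then obtain \<epsilon> where \<epsilon>: "\<epsilon> > 0" "\<forall>\<delta> (I::nat set) A. 0 \<le> \<delta> \<and> \<delta> \<le> \<epsilon> \<and> finite I \<and> card I = N \<and>
    psd_on I A \<and> (\<forall>i\<in>I. \<forall>j\<in>I. 0 < A i j) \<longrightarrow>
    psd_on I (\<lambda>i j. (\<Sum>e\<in>L \<union> U. c e * A i j ^ e) - \<delta> * A i j ^ M)"
    by (elim exE conjE)
  define g where "g x = (\<Sum>e\<in>L \<union> U. c e * x ^ e) - \<epsilon> * x ^ M" for x :: real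
  define f where "f = (\<lambda>x. (\<Sum>j<N. complex_of_real (c (n j)) * x ^ n j)
         + complex_of_real (- \<epsilon>) * x ^ M
         + (\<Sum>j=N..<2 * N. complex_of_real (c (n j)) * x ^ n j))"
  have f_of_real: "f (complex_of_real x) = complex_of_real (g x)" for x
  proof -
    have "L \<inter> U = {}" using less_L less_U by fastforce
    then have "(\<Sum>e\<in>L \<union> U. c e * x ^ e) = (\<Sum>e\<in>L. c e * x ^ e) + (\<Sum>e\<in>U. c e * x ^ e)"
      by (intro sum.union_disjoint) (auto simp: L_def U_def)
    also have "\<dots> = (\<Sum>j<N. c (n j) * x ^ n j) + (\<Sum>j=N..<2 * N. c (n j) * x ^ n j)"
      by (simp add: L_def U_def sum.reindex inj_L inj_U)
    finally show ?thesis
      by (simp add: f_def g_def)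
  qed
  have "positive_semidefinite (map_mat f A)" if "A \<in> psd_matrices N (complex_of_real ` {0<..})" for A
  proof -
    have A: "A \<in> carrier_mat N N" "positive_semidefinite A"
      "elements_mat A \<subseteq> complex_of_real ` {0<..}"
      using that by (auto simp: psd_matrices_def)
    define a where "a i j = Re (A $$ (i, j))" for i j
    have a: "A $$ (i, j) = complex_of_real (a i j)" "0 < a i j" if "i < N" "j < N" for i j
    proof -
      have "A $$ (i, j) \<in> complex_of_real ` {0<..}"
        using A(1,3) that elements_matI by blast
      then show "A $$ (i, j) = complex_of_real (a i j)" "0 < a i j"
        by (auto simp: a_def)
    qed
    have "psd_on {..<N} a"
      using positive_semidefinite_of_real_iff[OF A(1) a(1)] A(2) by simp
    then have "psd_on {..<N} (\<lambda>i j. g (a i j))"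
      using \<epsilon> a(2) unfolding g_def by simp
    moreover have "map_mat f A $$ (i, j) = complex_of_real (g (a i j))" if "i < N" "j < N" for i j
      using A(1) that a(1) by (simp add: f_of_real)
    ultimately show ?thesis
      using positive_semidefinite_of_real_iff[of "map_mat f A" N "\<lambda>i j. g (a i j)"] A(1) by simp
  qed
  then have "entrywise_preserves_positivity N (complex_of_real ` {0<..}) f"
    by (simp add: entrywise_preserves_positivity_def)
  then show ?thesis
    unfolding f_def using \<epsilon>(1) by (intro exI[of _ "- \<epsilon>"]) simp
qed

end
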